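(* Let $I,J,K\ge1$. Suppose there are no missing or duplicate rankings, i.e. $(t_i)_{i\in[I]}$ is a permutation of $[I]$ and, for each $i$, $(s_{ij})_{j\in[J]}$ is a permutation of $[J]$. For every $i\in[I]$ and $r\in[K]$, the optimal weight $w^*_{ir}$ of the alternative ranked $r$ under expert $i$ in OPA decomposes as the product of the weight $W_i^{\mathcal Q}$ of expert $i$ and a rank-based net utility $u_{ir}$: that is, there are numbers $u_{ir}$ and a function $f:\mathbb R\to\mathbb R$ with $u_{ir}=f(r)$ for all $i\in[I]$, $r\in[K]$ such that $$w^*_{ir}=W_i^{\mathcal Q}\,u_{ir},\qquad\forall i\in[I],\ r\in[K].$$
   Context: $[n]=\{1,\dots,n\}$. For given positive integers $t_i$ (rank of expert $i\in[I]$) and $s_{ij}$ (rank of attribute $j\in[J]$ given by expert $i$), and $K$ alternatives ranked by each expert under each attribute without missing or duplicate ranks, the OPA model is the linear program in $z\in\mathbb R$ and $\mathbf w=(w_{ijr})_{i\in[I],j\in[J],r\in[K]}$: $$\max z\ \text{ s.t. }\Big(\sum_{h=r}^{K}\tfrac1h\Big)z\le t_is_{ij}w_{ijr}\ \forall i,j,r,\quad\sum_{i,j,r}w_{ijr}=1,\quad w_{ijr}\ge0.$$ Let $w^*_{ijr}$ be its optimal solution. Define $w^*_{ir}=\sum_{j=1}^Jw^*_{ijr}$ and $W_i^{\mathcal Q}=\sum_{j=1}^J\sum_{r=1}^Kw^*_{ijr}$. A utility is called a rank-based net utility if its value is determined solely by the ranking position $r$, i.e. it equals $f(r)$ for some $f:\mathbb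 R\to\mathbb R$. *)

theory Defs
  imports Complex_Main
begin

text \<open>
  Experts, attributes and ranks are indexed by the sets \<open>{1..I}\<close>, \<open>{1..J}\<close> and \<open>{1..K}\<close>; the values of
  \<open>t\<close>, \<open>s\<close> and \<open>w\<close> outside these ranges are irrelevant. The variable \<open>w i j r\<close> is the weight of the
  alternative that expert \<open>i\<close> ranks in position \<open>r\<close> under attribute \<open>j\<close>; when every rank occurs exactly
  once, the program depends on the rankings of the alternatives only through \<open>K\<close>.
\<close>

definition opa_feasible ::
  "nat \<Rightarrow> nat \<Rightarrow> nat \<Rightarrow> (nat \<Rightarrow> nat) \<Rightarrow> (nat \<Rightarrow> nat \<Rightarrow> nat) \<Rightarrow> real \<Rightarrow> (nat \<Rightarrow> nat \<Rightarrow> nat \<Rightarrow> real) \<Rightarrow> bool"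
  where
  "opa_feasible I J K t s z w \<longleftrightarrow>
     (\<forall>i\<in>{1..I}. \<forall>j\<in>{1..J}. \<forall>r\<in>{1..K}.
        (\<Sum>h=r..K. 1 / real h) * z \<le> real (t i) * real (s i j) * w i j r) \<and>
     (\<Sum>i=1..I. \<Sum>j=1..J. \<Sum>r=1..K. w i j r) = 1 \<and>
     (\<forall>i\<in>{1..I}. \<forall>j\<in>{1..J}. \<forall>r\<in>{1..K}. 0 \<le> w i j r)"

definition opa_optimal ::
  "nat \<Rightarrow> nat \<Rightarrow> nat \<Rightarrow> (nat \<Rightarrow> nat) \<Rightarrow> (nat \<Rightarrow> nat \<Rightarrow> nat) \<Rightarrow> real \<Rightarrow> (nat \<Rightarrow> nat \<Rightarrow> nat \<Rightarrow> real) \<Rightarrow> bool"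
  where
  "opa_optimal I J K t s z w \<longleftrightarrow>
     opa_feasible I J K t s z w \<and> (\<forall>z' w'. opa_feasible I J K t s z' w' \<longrightarrow> z' \<le> z)"

definition rank_weight :: "nat \<Rightarrow> (nat \<Rightarrow> nat \<Rightarrow> nat \<Rightarrow> real) \<Rightarrow> nat \<Rightarrow> nat \<Rightarrow> real" where
  "rank_weight J w i r = (\<Sum>j=1..J. w i j r)"

definition expert_weight :: "nat \<Rightarrow> nat \<Rightarrow> (nat \<Rightarrow> nat \<Rightarrow> nat \<Rightarrow> real) \<Rightarrow> nat \<Rightarrow> real" where
  "expert_weight J K w i = (\<Sum>j=1..J. \<Sum>r=1..K. w i j r)"

text \<open>A single \<open>f\<close> serves all experts: the utility depends on the ranking position alone.\<close>

definition rank_based_net_utility :: "nat \<Rightarrow> nat \<Rightarrow> (nat \<Rightarrow> nat \<Rightarrow> real) \<Rightarrow> bool" where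
  "rank_based_net_utility I K u \<longleftrightarrow>
     (\<exists>f :: real \<Rightarrow> real. \<forall>i\<in>{1..I}. \<forall>r\<in>{1..K}. u i r = f (real r))"

end

theory Submission
  imports Defs
begin

text \<open>
  With \<open>c i j r = (\<Sum>h=r..K. 1 / h) / (t i * s i j)\<close> the ranking constraints read \<open>c i j r * z \<le> w i j r\<close>.
  Scaling \<open>c\<close> to total weight 1 gives a feasible point with objective \<open>1 / (\<Sum> c)\<close>, so an optimal \<open>z\<close> is at
  least that; summing the constraints then leaves no slack, and \<open>w = z * c\<close>. This is a product of a
  factor in \<open>(i, j)\<close> and a factor in \<open>r\<close>.
\<close>

lemma opa_optimal_tight:
  fixes t :: "nat \<Rightarrow> nat" and s :: "nat \<Rightarrow> nat \<Rightarrow> nat"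
  assumes opt: "opa_optimal I J K t s z w"
    and t_pos: "\<And>i. i \<in> {1..I} \<Longrightarrow> t i > 0"
    and s_pos: "\<And>i j. i \<in> {1..I} \<Longrightarrow> j \<in> {1..J} \<Longrightarrow> s i j > 0"
    and ijr: "i \<in> {1..I}" "j \<in> {1..J}" "r \<in> {1..K}"
  shows "w i j r = (\<Sum>h=r..K. 1 / real h) * z / (real (t i) * real (s i j))"
proof -
  define c where "c = (\<lambda>i j r. (\<Sum>h=r..K. 1 / real h) / (real (t i) * real (s i j)))"
  define A where "A = {1..I} \<times> {1..J} \<times> {1..K}"
  define C where "C = (\<Sum>(i, j, r)\<in>A. c i j r)"
  \<comment> \<open>Flattening the nested sums over \<open>A\<close> lets a single argument about a
    finite sum of nonnegative terms settle all constraints at once.\<close>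
  have triple: "(\<Sum>i=1..I. \<Sum>j=1..J. \<Sum>r=1..K. f i j r) = (\<Sum>(i, j, r)\<in>A. f i j r)"
    for f :: "nat \<Rightarrow> nat \<Rightarrow> nat \<Rightarrow> real"
    unfolding A_def by (simp add: sum.cartesian_product)
  have c_pos: "c i j r > 0" if "i \<in> {1..I}" "j \<in> {1..J}" "r \<in> {1..K}" for i j r
    unfolding c_def using that t_pos s_pos
    by (intro divide_pos_pos mult_pos_pos sum_pos) auto
  \<comment> \<open>The given triple \<open>(i, j, r)\<close> ensures that \<open>A\<close> is
    nonempty.\<close>
  have C_pos: "C > 0"
    unfolding C_def using ijr c_pos by (intro sum_pos) (auto simp: A_def)
  have "opa_feasible I J K t s (1 / C) (\<lambda>i j r. c i j r / C)"
  proof -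
    have "(\<Sum>(i, j, r)\<in>A. c i j r / C) = 1"
      using C_pos by (simp add: case_prod_unfold C_def flip: sum_divide_distrib)
    \<comment> \<open>Equality holds here: the denominator of \<open>c\<close> cancels
      \<open>t i * s i j\<close>.\<close>
    moreover have "(\<Sum>h=r..K. 1 / real h) * (1 / C) \<le> real (t i) * real (s i j) * (c i j r / C)"
      if "i \<in> {1..I}" "j \<in> {1..J}" for i j r
      using t_pos[OF that(1)] s_pos[OF that] by (simp add: c_def)
    ultimately show ?thesis
      unfolding opa_feasible_def triple using C_pos c_pos by (auto simp: less_imp_le)
  qed
  then have z_ge: "1 / C \<le> z"
    using opt unfolding opa_optimal_def by blast
  have feas: "opa_feasible I J K t s z w"
    using opt unfolding opa_optimal_def by blast
  have slack: "c i j r * z \<le> w i j r" if "i \<in> {1..I}" "j \<in> {1..J}" "r \<in> {1..K}" for i j r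
  proof -
    have "(\<Sum>h=r..K. 1 / real h) * z \<le> real (t i) * real (s i j) * w i j r"
      using feas that unfolding opa_feasible_def by blast
    then show ?thesis
      using t_pos[OF that(1)] s_pos[OF that(1,2)] by (simp add: c_def field_simps)
  qed
  \<comment> \<open>Total slack: the weights sum to 1 and \<open>c\<close> sums to \<open>C\<close>,
    so \<open>1 / C \<le> z\<close> bounds it above by 0, while each term is nonnegative.\<close>
  have "(\<Sum>(i, j, r)\<in>A. w i j r - c i j r * z) = 1 - C * z"
    using feas unfolding opa_feasible_def triple C_def
    by (simp add: case_prod_unfold sum_subtractf sum_distrib_right)
  also have "\<dots> \<le> 0"
    using z_ge C_pos by (simp add: field_simps)
  finally have "(\<Sum>(i, j, r)\<in>A. w i j r - c i j r * z) = 0"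
    using slack by (intro antisym sum_nonneg) (auto simp: A_def)
  then have "\<forall>(i, j, r)\<in>A. w i j r - c i j r * z = 0"
    using slack by (subst (asm) sum_nonneg_eq_0_iff) (auto simp: A_def)
  then show ?thesis
    using ijr by (auto simp: A_def c_def)
qed

theorem proposition2:
  fixes I J K :: nat
    and t :: "nat \<Rightarrow> nat"
    and s :: "nat \<Rightarrow> nat \<Rightarrow> nat"
    and z :: real
    and w :: "nat \<Rightarrow> nat \<Rightarrow> nat \<Rightarrow> real"
  assumes "I \<ge> 1" and "J \<ge> 1" and "K \<ge> 1"
    and "bij_betw t {1..I} {1..I}"
    and "\<And>i. i \<in> {1..I} \<Longrightarrow> bij_betw (s i) {1..J} {1..J}"
    and "opa_optimal I J K t s z w"
  shows "\<exists>u. rank_based_net_utility I K u \<and>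
           (\<forall>i\<in>{1..I}. \<forall>r\<in>{1..K}. rank_weight J w i r = expert_weight J K w i * u i r)"
proof -
  define H where "H = (\<lambda>r. \<Sum>h=r..K. 1 / real h)"
  define S where "S = (\<Sum>r=1..K. H r)"
  \<comment> \<open>\<open>a\<close> collects everything in the tight weight that does not depend on
    \<open>r\<close>.\<close>
  define a where "a = (\<lambda>i j. z / (real (t i) * real (s i j)))"
  have "S > 0"
    unfolding S_def H_def using \<open>K \<ge> 1\<close> by (intro sum_pos) auto
  have t_pos: "t i > 0" if "i \<in> {1..I}" for i
    using bij_betwE[OF assms(4)] that by fastforce
  have s_pos: "s i j > 0" if "i \<in> {1..I}" "j \<in> {1..J}" for i j
    using bij_betwE[OF assms(5)[OF that(1)]] that(2) by fastforce
  have w_eq: "w i j r = a i j * H r" if "i \<in> {1..I}" "j \<in> {1..J}" "r \<in> {1..K}" for i j r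
    using opa_optimal_tight[OF assms(6) t_pos s_pos that] by (simp add: a_def H_def)
  \<comment> \<open>Summing \<open>a i j * H r\<close> over \<open>j\<close> alone leaves the factor
    \<open>H r\<close>; summing over \<open>r\<close> too replaces it by \<open>S\<close>. The ratio
    \<open>H r / S\<close> is thus the same for every expert.\<close>
  have "rank_weight J w i r = expert_weight J K w i * (H r / S)"
    if "i \<in> {1..I}" "r \<in> {1..K}" for i r
  proof -
    have "rank_weight J w i r = (\<Sum>j=1..J. a i j) * H r"
      unfolding rank_weight_def sum_distrib_right using that by (intro sum.cong refl w_eq)
    moreover have "expert_weight J K w i = (\<Sum>j=1..J. \<Sum>r=1..K. a i j * H r)"
      unfolding expert_weight_def using that by (intro sum.cong refl w_eq)
    moreover have "\<dots> = (\<Sum>j=1..J. a i j) * S"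
      by (simp add: S_def sum_product)
    ultimately show ?thesis
      using \<open>S > 0\<close> by simp
  qed
  moreover have "rank_based_net_utility I K (\<lambda>i r. H r / S)"
    unfolding rank_based_net_utility_def
    \<comment> \<open>\<open>f\<close> must take real arguments, so \<open>H\<close> is extended by
      the floor, which returns \<open>r\<close> at \<open>real r\<close>.\<close>
    by (rule exI[of _ "\<lambda>x. H (nat \<lfloor>x\<rfloor>) / S"]) simp
  ultimately show ?thesis
    by (intro exI[of _ "\<lambda>i r. H r / S"]) blast
qed

end
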